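(* Let $F_q$ be a finite field with $q$ elements $f_1, f_2, \dots, f_q$. Let $R$ be an associative algebra with unity over $F_q$ and let $P$ be a polynomial of degree $q$ in one variable with coefficients in $F_q$. Let $a, b$ be any two elements of $R$ such that $b^q - b$ lies in the center of $R$. If $\sum_{i=1}^{q} P(a + f_i b) \in C_b$, then $ab = ba$.
   Context: For an element $b$ of a ring $R$, $C_b$ denotes the set of all elements of $R$ which commute with $b$. All rings and algebras are associative with unity; $R$ is not assumed commutative or finite. *)

theory Defs
  imports
    "HOL-Library.Cardinality"
    "HOL-Computational_Algebra.Polynomial"
begin

text \<open>
  Rings with unity are taken in the sort \<open>{ring, monoid_mult}\<close> rather than \<open>ring_1\<close>: the latter
  requires \<open>0 \<noteq> 1\<close> and would exclude the zero ring.
\<close>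

locale unital_algebra = module scale
  for scale :: "'k::field \<Rightarrow> 'r::{ring,monoid_mult} \<Rightarrow> 'r" (infixr \<open>*\<^sub>A\<close> 75) +
  assumes mult_scale_left: "(c *\<^sub>A x) * y = c *\<^sub>A (x * y)"
    and mult_scale_right: "x * (c *\<^sub>A y) = c *\<^sub>A (x * y)"
begin

text \<open>The library's \<^const>\<open>poly\<close> evaluates only within one commutative semiring.\<close>

definition peval :: "'k poly \<Rightarrow> 'r \<Rightarrow> 'r" where
  "peval P x = (\<Sum>i\<le>degree P. coeff P i *\<^sub>A x ^ i)"

end

definition centralizer :: "'r::times \<Rightarrow> 'r set" where
  "centralizer b = {x. x * b = b * x}"

definition ring_center :: "'r::times set" where
  "ring_center = {z. \<forall>x. z * x = x * z}"

end

theory Submission imports Defs begin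

text \<open>
  Write \<open>(a + t b)\<^sup>k = \<Sum>\<^sub>j t\<^sup>j W\<^sub>k\<^sub>,\<^sub>j\<close>, where \<open>W\<^sub>k\<^sub>,\<^sub>j\<close> is the sum of all words with \<open>k - j\<close>
  letters \<open>a\<close> and \<open>j\<close> letters \<open>b\<close>. Summing over \<open>t \<in> F\<^sub>q\<close> replaces \<open>t\<^sup>j\<close> by the power sum
  \<open>\<sigma>\<^sub>j = \<Sum>\<^sub>t t\<^sup>j\<close>. This vanishes for \<open>j < q - 1\<close> (\<open>power_sum_eq_0\<close>), while \<open>\<sigma>\<^bsub>q-1\<^esub> = -1\<close>; only
  \<open>\<sigma>\<^bsub>q-1\<^esub> \<noteq> 0\<close> matters here (\<open>power_sum_card_minus_1_neq_0\<close>). Hence for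
  \<open>k \<le> q\<close> the only words that survive have at most one letter \<open>a\<close>, and a word with exactly one
  \<open>a\<close> survives only for \<open>k = q\<close>. Powers of \<open>b\<close> commute with \<open>b\<close>, so modulo the centralizer of
  \<open>b\<close> the whole sum \<open>\<Sum>\<^sub>t P(a + t b)\<close> is \<open>- c \<Sum>\<^sub>i b\<^sup>i a b\<^bsup>q-1-i\<^esup>\<close>, where \<open>c \<noteq> 0\<close> is the
  leading coefficient of \<open>P\<close>. The commutator of \<open>b\<close> with \<open>\<Sum>\<^sub>i b\<^sup>i a b\<^bsup>q-1-i\<^esup>\<close> telescopes to
  \<open>b\<^sup>q a - a b\<^sup>q\<close> (\<open>commutator_word_sum_one_a\<close>). So the hypothesis says that \<open>b\<^sup>q\<close> commutes with \<open>a\<close>; as \<open>b\<^sup>q - b\<close> is central,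
  \<open>b\<close> commutes with \<open>a\<close> as well.
\<close>

section \<open>Power sums over a finite field\<close>

text \<open>Multiplication by \<open>g \<noteq> 0\<close> permutes the field, so \<open>g\<^sup>j \<sigma>\<^sub>j = \<sigma>\<^sub>j\<close>. For \<open>0 < j < q - 1\<close> the
  polynomial \<open>x\<^sup>j - 1\<close> has too few roots to vanish at all nonzero \<open>g\<close>. For \<open>j = 0\<close> the sum is
  \<open>q \<cdot> 1\<close>, which translation by \<open>1\<close> shows to be zero.\<close>

lemma power_sum_eq_0:
  fixes j :: nat
  assumes "Suc j < CARD('k::{field,finite})"
  shows "(\<Sum>t\<in>(UNIV::'k set). t ^ j) = 0"
proof (cases "j = 0")
  case True
  have "(\<Sum>t\<in>(UNIV::'k set). t + 1) = (\<Sum>t\<in>(UNIV::'k set). t)"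
    by (rule sum.reindex_bij_witness[where i = "\<lambda>t. t - 1" and j = "\<lambda>t. t + 1"]) auto
  then show ?thesis
    using True by (simp add: sum.distrib)
next
  case False
  define p :: "'k poly" where "p = monom 1 j - 1"
  have "coeff p j = 1"
    using False by (simp add: p_def)
  then have p: "p \<noteq> 0"
    by auto
  have "degree p \<le> j"
    by (simp add: p_def degree_diff_le degree_monom_le)
  then have roots: "card {x. poly p x = 0} \<le> j"
    using card_poly_roots_bound[OF p] by linarith
  have "\<exists>g::'k. g \<noteq> 0 \<and> g ^ j \<noteq> 1"
  proof (rule ccontr)
    assume "\<not> ?thesis"
    then have "UNIV - {0} \<subseteq> {x. poly p x = 0}"
      by (auto simp: p_def poly_monom)
    then have "card (UNIV - {0::'k}) \<le> card {x. poly p x = 0}"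
      by (intro card_mono) auto
    then show False
      using roots assms by (simp add: card_Diff_singleton)
  qed
  then obtain g :: 'k where g: "g \<noteq> 0" "g ^ j \<noteq> 1"
    by blast
  have "(\<Sum>t\<in>(UNIV::'k set). (g * t) ^ j) = (\<Sum>t\<in>(UNIV::'k set). t ^ j)"
    by (rule sum.reindex_bij_witness[where i = "\<lambda>t. t / g" and j = "\<lambda>t. g * t"]) (use g in auto)
  then have "g ^ j * (\<Sum>t\<in>(UNIV::'k set). t ^ j) = (\<Sum>t\<in>(UNIV::'k set). t ^ j)"
    by (simp only: power_mult_distrib sum_distrib_left)
  then show ?thesis
    using g by simp
qed

text \<open>If \<open>\<sigma>\<^bsub>q-1\<^esub>\<close> vanished too, the values of every polynomial of degree at most \<open>q - 1\<close> would
  sum to zero. But \<open>\<Prod>\<^bsub>s \<noteq> 0\<^esub> (x - s)\<close> is nonzero exactly at \<open>x = 0\<close>.\<close>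

lemma power_sum_card_minus_1_neq_0:
  "(\<Sum>t\<in>(UNIV::'k::{field,finite} set). t ^ (CARD('k) - 1)) \<noteq> 0"
proof
  assume top: "(\<Sum>t\<in>(UNIV::'k set). t ^ (CARD('k) - 1)) = 0"
  define p :: "'k poly" where "p = (\<Prod>s\<in>UNIV - {0}. [:- s, 1:])"
  have "degree p = (\<Sum>s\<in>UNIV - {0::'k}. degree [:- s, 1:])"
    unfolding p_def by (rule degree_prod_eq_sum_degree) auto
  then have deg: "degree p = CARD('k) - 1"
    by (simp add: card_Diff_singleton)
  have power_sums: "(\<Sum>t\<in>(UNIV::'k set). t ^ j) = 0" if "j \<le> degree p" for j
    using that power_sum_eq_0[where 'k = 'k, of j] top deg
    by (cases "j = CARD('k) - 1") auto
  have "(\<Sum>t\<in>UNIV. poly p t) = (\<Sum>j\<le>degree p. coeff p j * (\<Sum>t\<in>UNIV. t ^ j))"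
    unfolding poly_altdef sum_distrib_left by (rule sum.swap)
  also have "\<dots> = 0"
    using power_sums by simp
  finally have "(\<Sum>t\<in>UNIV. poly p t) = 0" .
  moreover have "poly p t = 0" if "t \<noteq> 0" for t
    using that by (auto simp: p_def poly_prod)
  then have "(\<Sum>t\<in>UNIV. poly p t) = (\<Sum>t\<in>{0}. poly p t)"
    by (intro sum.mono_neutral_right) auto
  moreover have "poly p 0 \<noteq> 0"
    by (simp add: p_def poly_prod)
  ultimately show False
    by simp
qed

section \<open>Words in two letters\<close>

text \<open>The sum of all words of length \<open>k\<close> with \<open>j\<close> letters \<open>b\<close> and \<open>k - j\<close> letters \<open>a\<close>, split by
  the first letter.\<close>

fun word_sum :: "'r::{ring,monoid_mult} \<Rightarrow> 'r \<Rightarrow> nat \<Rightarrow> nat \<Rightarrow> 'r" where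
  "word_sum a b 0 0 = 1"
| "word_sum a b 0 (Suc j) = 0"
| "word_sum a b (Suc k) 0 = a * word_sum a b k 0"
| "word_sum a b (Suc k) (Suc j) = a * word_sum a b k (Suc j) + b * word_sum a b k j"

lemma word_sum_eq_0: "k < j \<Longrightarrow> word_sum a b k j = 0"
  by (induction a b k j rule: word_sum.induct) auto

lemma word_sum_all_b: "word_sum a b k k = b ^ k"
  by (induction k) (simp_all add: word_sum_eq_0)

text \<open>Here the word sum is \<open>\<Sum>\<^bsub>i\<le>k\<^esub> b\<^sup>i a b\<^bsup>k-i\<^esup>\<close>, so the commutator telescopes.\<close>

lemma commutator_word_sum_one_a:
  "b * word_sum a b (Suc k) k - word_sum a b (Suc k) k * b = b ^ Suc k * a - a * b ^ Suc k"
proof (induction k)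
  case 0
  show ?case by simp
next
  case (Suc k)
  define T where "T = word_sum a b (Suc k) k"
  have Tb: "T * b = b * T - (b ^ Suc k * a - a * b ^ Suc k)"
    using Suc unfolding T_def by (simp add: algebra_simps)
  have step: "word_sum a b (Suc (Suc k)) (Suc k) = a * b ^ Suc k + b * T"
    by (simp only: word_sum.simps(4)[of a b "Suc k" k] word_sum_all_b T_def)
  have bk: "b ^ Suc k * b = b ^ Suc (Suc k)"
    by (simp only: power_Suc2)
  have "(a * b ^ Suc k + b * T) * b = a * b ^ Suc (Suc k) + b * (T * b)"
    by (simp only: distrib_right mult.assoc bk)
  also have "\<dots> = a * b ^ Suc (Suc k)
      + (b * (b * T) - (b ^ Suc (Suc k) * a - b * (a * b ^ Suc k)))"
    by (simp only: Tb right_diff_distrib power_Suc[of b "Suc k"] mult.assoc)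
  finally show ?case
    unfolding step by (simp only: distrib_left) (simp only: algebra_simps)
qed

section \<open>Summing a polynomial over a line\<close>

context unital_algebra
begin

lemma power_add_scale:
  "(a + t *\<^sub>A b) ^ k = (\<Sum>j\<le>k. t ^ j *\<^sub>A word_sum a b k j)"
proof (induction k)
  case 0
  show ?case by simp
next
  case (Suc k)
  let ?W = "word_sum a b"
  have "(\<Sum>j\<le>Suc k. t ^ j *\<^sub>A ?W (Suc k) j)
      = a * ?W k 0 + (\<Sum>j\<le>k. t ^ Suc j *\<^sub>A (a * ?W k (Suc j)))
        + (\<Sum>j\<le>k. t ^ Suc j *\<^sub>A (b * ?W k j))"
    unfolding sum.atMost_Suc_shift by (simp add: scale_right_distrib sum.distrib)
  also have "a * ?W k 0 + (\<Sum>j\<le>k. t ^ Suc j *\<^sub>A (a * ?W k (Suc j)))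
      = (\<Sum>j\<le>Suc k. t ^ j *\<^sub>A (a * ?W k j))"
    unfolding sum.atMost_Suc_shift by simp
  also have "\<dots> = a * (\<Sum>j\<le>k. t ^ j *\<^sub>A ?W k j)"
    by (simp add: word_sum_eq_0 sum_distrib_left mult_scale_right)
  also have "(\<Sum>j\<le>k. t ^ Suc j *\<^sub>A (b * ?W k j)) = (t *\<^sub>A b) * (\<Sum>j\<le>k. t ^ j *\<^sub>A ?W k j)"
    by (simp add: sum_distrib_left mult_scale_right mult_scale_left mult.commute)
  finally show ?case
    by (simp add: Suc distrib_right)
qed

lemma sum_power_add_scale:
  "(\<Sum>t\<in>A. (a + t *\<^sub>A b) ^ k) = (\<Sum>j\<le>k. (\<Sum>t\<in>A. t ^ j) *\<^sub>A word_sum a b k j)"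
  unfolding power_add_scale scale_sum_left by (rule sum.swap)

end

text \<open>Only words with at most one letter \<open>a\<close> survive the summation, and powers of \<open>b\<close> do not
  contribute to the commutator.\<close>

lemma commutator_sum_power_add_scale:
  fixes scale :: "'k::{field,finite} \<Rightarrow> 'r::{ring,monoid_mult} \<Rightarrow> 'r"
    and a b :: 'r
  assumes "unital_algebra scale" and "k \<le> CARD('k)"
  defines "S \<equiv> \<Sum>t\<in>UNIV. (a + scale t b) ^ k"
  shows "b * S - S * b =
    (if k = CARD('k)
     then scale (\<Sum>t\<in>(UNIV::'k set). t ^ (CARD('k) - 1)) (b ^ k * a - a * b ^ k) else 0)"
proof -
  interpret unital_algebra scale by fact
  define \<sigma> where "\<sigma> j = (\<Sum>t\<in>(UNIV::'k set). t ^ j)" for j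
  have S: "S = (\<Sum>j\<le>k. scale (\<sigma> j) (word_sum a b k j))"
    unfolding S_def \<sigma>_def by (rule sum_power_add_scale)
  show ?thesis
  proof (cases k)
    case 0
    then show ?thesis
      by (simp add: S mult_scale_left mult_scale_right)
  next
    case (Suc m)
    have "\<sigma> j = 0" if "j < m" for j
      using that power_sum_eq_0[where 'k = 'k, of j] assms(2) Suc by (simp add: \<sigma>_def)
    then have "S = scale (\<sigma> m) (word_sum a b k m) + scale (\<sigma> k) (b ^ k)"
      unfolding S Suc by (simp add: lessThan_Suc_atMost[symmetric] word_sum_all_b
          del: word_sum.simps power_Suc)
    then have "b * S - S * b = scale (\<sigma> m) (b * word_sum a b k m - word_sum a b k m * b)"
      by (simp add: distrib_left distrib_right mult_scale_left mult_scale_right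
          scale_right_diff_distrib power_commutes)
    then have "b * S - S * b = scale (\<sigma> m) (b ^ k * a - a * b ^ k)"
      unfolding Suc commutator_word_sum_one_a .
    moreover have "\<sigma> m = 0" if "k \<noteq> CARD('k)"
      using that power_sum_eq_0[where 'k = 'k, of m] assms(2) Suc by (simp add: \<sigma>_def)
    moreover have "m = CARD('k) - 1" if "k = CARD('k)"
      using that Suc by simp
    ultimately show ?thesis
      unfolding \<sigma>_def by auto
  qed
qed

section \<open>The commutativity criterion\<close>

theorem lemma1p1:
  fixes scale :: "'k::{field,finite} \<Rightarrow> 'r::{ring,monoid_mult} \<Rightarrow> 'r"
    and q :: nat
    and f :: "nat \<Rightarrow> 'k"
    and P :: "'k poly"
    and a b :: 'r
  assumes "unital_algebra scale"
    and "q = CARD('k)"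
    and "bij_betw f {1..q} UNIV"
    and "degree P = q"
    and "b ^ q - b \<in> ring_center"
    and "(\<Sum>i=1..q. unital_algebra.peval scale P (a + scale (f i) b)) \<in> centralizer b"
  shows "a * b = b * a"
proof -
  interpret unital_algebra scale by fact
  define S where "S k = (\<Sum>t\<in>UNIV. (a + scale t b) ^ k)" for k
  define \<sigma> where "\<sigma> = (\<Sum>t\<in>(UNIV::'k set). t ^ (CARD('k) - 1))"
  have q: "0 < q"
    using assms(2) by simp
  have comm: "b * S k - S k * b = (if k = q then scale \<sigma> (b ^ q * a - a * b ^ q) else 0)"
    if "k \<le> q" for k
    using commutator_sum_power_add_scale[OF assms(1), of k b a] that assms(2)
    by (auto simp: S_def \<sigma>_def)
  have "(\<Sum>i=1..q. peval P (a + scale (f i) b)) = (\<Sum>t\<in>UNIV. peval P (a + scale t b))"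
    by (rule sum.reindex_bij_betw[OF assms(3)])
  also have "\<dots> = (\<Sum>k\<le>q. scale (coeff P k) (S k))"
    unfolding peval_def S_def scale_sum_right assms(4) by (rule sum.swap)
  finally have "b * (\<Sum>k\<le>q. scale (coeff P k) (S k)) - (\<Sum>k\<le>q. scale (coeff P k) (S k)) * b = 0"
    using assms(6) by (simp add: centralizer_def)
  then have "(\<Sum>k\<le>q. scale (coeff P k) (b * S k - S k * b)) = 0"
    by (simp add: sum_distrib_left sum_distrib_right mult_scale_left mult_scale_right
        scale_right_diff_distrib sum_subtractf)
  moreover have "(\<Sum>k\<le>q. scale (coeff P k) (b * S k - S k * b))
      = (\<Sum>k\<in>{q}. scale (coeff P k) (b * S k - S k * b))"
    by (rule sum.mono_neutral_right) (auto simp: comm)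
  ultimately have zero: "scale (coeff P q * \<sigma>) (b ^ q * a - a * b ^ q) = 0"
    by (simp add: comm)
  have "coeff P q \<noteq> 0"
    using assms(4) q leading_coeff_neq_0[of P] by auto
  then have unit: "coeff P q * \<sigma> \<noteq> 0"
    using power_sum_card_minus_1_neq_0[where 'k = 'k] by (simp add: \<sigma>_def)
  have "b ^ q * a - a * b ^ q
      = scale (inverse (coeff P q * \<sigma>)) (scale (coeff P q * \<sigma>) (b ^ q * a - a * b ^ q))"
    by (simp only: scale_scale left_inverse[OF unit] scale_one)
  then have "b ^ q * a = a * b ^ q"
    by (simp add: zero)
  moreover have "(b ^ q - b) * a = a * (b ^ q - b)"
    using assms(5) by (simp add: ring_center_def)
  ultimately show ?thesis
    by (simp add: left_diff_distrib right_diff_distrib)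
qed

end
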